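(* Let $\beta>0$ and $-1<\sigma<0$ be constants. For any $T>0$, let $\Delta t$ be the time step and $N=\frac{T}{\Delta t}$. Suppose $h^n$, $h^{n*}$ and $\tilde h^n$ (together with the endpoints $a^n,b^n$) are obtained from the projection method described in the context. Then the following stability estimates hold: (i) for the endpoints, for $0\le n\le N$, $$a^0+\sigma T\le a^n\le a^0+(1+\sigma)T,\qquad b^0-(1+\sigma)T\le b^n\le b^0-\sigma T;$$ (ii) for the capillary surface, $$\max_{1\le n\le N}\int_{a^n}^{b^n}\sqrt{1+(\partial_x h^n)^2}\,dx+\frac{\beta}{\Delta t}\sum_{n=0}^{N-1}\int_{a^{n+1}}^{b^{n+1}}\frac{|\tilde h^{n+1}-h^{n*}|^2}{\sqrt{1+(\partial_x\tilde h^{n+1})^2}}\,dx\ \le\ 8T+2\int_{a^0}^{b^0}\sqrt{1+(\partial_x h^0)^2}\,dx .$$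
   Context: The projection method computes the motion of a two-dimensional droplet placed on a horizontal plane, without gravity and without volume constraint. At time step $n$ the droplet has endpoints (contact points) $a^n,b^n$ and a height profile $h^n$ on $[a^n,b^n]$; the initial data are $a^0$, $b^0$ and a profile $h^0\ge0$ on $[a^0,b^0]$ vanishing at the endpoints. The constant $\sigma$ is the relative adhesion coefficient and $\beta$ the dimensionless friction coefficient of the capillary surface. One time step is as follows. Step 1 (explicit boundary update): $$\frac{a^{n+1}-a^n}{\Delta t}=\sigma+\frac{1}{\sqrt{1+(\partial_xh^n)^2}}\Big|_{a^n},\qquad \frac{b^{n+1}-b^n}{\Delta t}=-\sigma-\frac{1}{\sqrt{1+(\partial_xh^n)^2}}\Big|_{b^n}.$$ Step 2 (rescaling from $[a^n,b^n]$ to $[a^{n+1},b^{n+1}]$): for $x^{n+1}\in[a^{n+1},b^{n+1}]$ set $h^{n*}(x^{n+1}):=h^n(x^n)$, where $x^n$ is given by $\frac{x^n-a^n}{b^n-a^n}=\frac{x^{n+1}-a^{n+1}}{b^{n+1}-a^{n+1}}\in[0,1]$. Step 3 (implicit capillary surface update without the obstacle constraint): $\tilde h^{n+1}$ solves, with independent variable $x=x^{n+1}\in(a^{n+1},b^{n+1})$, $$\frac{\beta}{\sqrt{1+(\partial_x\tilde h^{n+1})^2}}\,\frac{\tilde h^{n+1}-h^{n*}}{\Delta t}=\frac{\partial}{\partial x}\left(\frac{\partial_x\tilde h^{n+1}+\partial_xh^{n*}}{\sqrt{1+(\partial_x\tilde h^{n+1})^2}+\sqrt{1+(\partial_xh^{n*})^2}}\right),\qquad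 \tilde h^{n+1}(a^{n+1})=\tilde h^{n+1}(b^{n+1})=0 .$$ Step 4 (projection due to the impermeable obstacle): $h^{n+1}=\max\{\tilde h^{n+1},0\}$. *)

theory Defs
  imports "HOL-Analysis.Analysis"
begin

text \<open>
  Absolute continuity on \<open>[a,b]\<close> (equivalently, \<open>f\<close> is the continuous representative of a
  \<open>W\<^sup>1\<^sup>,\<^sup>1\<close> function), in the form given by the fundamental theorem of calculus for Lebesgue
  integrals.  This is the regularity class of the profiles: the projection creates kinks, so
  \<open>C\<^sup>1\<close> would be too narrow.  Only the values of \<open>f\<close> on \<open>[a,b]\<close> matter.
\<close>

definition abs_cont_on :: "real \<Rightarrow> real \<Rightarrow> (real \<Rightarrow> real) \<Rightarrow> bool" where
  "abs_cont_on a b f \<longleftrightarrow>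
     (AE x\<in>{a<..<b} in lebesgue. f differentiable (at x)) \<and>
     deriv f absolutely_integrable_on {a..b} \<and>
     (\<forall>x\<in>{a..b}. f x = f a + integral {a..x} (deriv f))"

text \<open>Step 1.  The slopes at the contact points are one-sided derivatives.\<close>

definition endpoint_update ::
  "real \<Rightarrow> real \<Rightarrow> real \<Rightarrow> real \<Rightarrow> (real \<Rightarrow> real) \<Rightarrow> real \<Rightarrow> real \<Rightarrow> bool" where
  "endpoint_update \<sigma> dt a b h a' b' \<longleftrightarrow>
     (\<exists>p. (h has_real_derivative p) (at_right a) \<and>
          (a' - a) / dt = \<sigma> + 1 / sqrt (1 + p\<^sup>2)) \<and>
     (\<exists>q. (h has_real_derivative q) (at_left b) \<and>
          (b' - b) / dt = - \<sigma> - 1 / sqrt (1 + q\<^sup>2))"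

text \<open>Step 2: \<open>hs\<close> on \<open>[a',b']\<close> is the rescaling of \<open>h\<close> on \<open>[a,b]\<close>.\<close>

definition rescaled_profile ::
  "real \<Rightarrow> real \<Rightarrow> (real \<Rightarrow> real) \<Rightarrow> real \<Rightarrow> real \<Rightarrow> (real \<Rightarrow> real) \<Rightarrow> bool" where
  "rescaled_profile a b h a' b' hs \<longleftrightarrow>
     (\<forall>x\<in>{a..b}. \<forall>x'\<in>{a'..b'}.
        (x - a) / (b - a) = (x' - a') / (b' - a') \<longrightarrow> hs x' = h x)"

text \<open>
  Step 3.  Since \<open>hs\<close> has kinks in general, the equation is read almost everywhere, the flux being
  absolutely continuous (after modification on a null set).  This is the same as the equation in
  the sense of distributions on \<open>(a,b)\<close>; in particular no flux is lost at a kink.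
\<close>

definition capillary_flux :: "(real \<Rightarrow> real) \<Rightarrow> (real \<Rightarrow> real) \<Rightarrow> real \<Rightarrow> real" where
  "capillary_flux u v x =
     (deriv u x + deriv v x) / (sqrt (1 + (deriv u x)\<^sup>2) + sqrt (1 + (deriv v x)\<^sup>2))"

definition capillary_update ::
  "real \<Rightarrow> real \<Rightarrow> real \<Rightarrow> real \<Rightarrow> (real \<Rightarrow> real) \<Rightarrow> (real \<Rightarrow> real) \<Rightarrow> bool" where
  "capillary_update \<beta> dt a b hs u \<longleftrightarrow>
     abs_cont_on a b u \<and> u a = 0 \<and> u b = 0 \<and>
     (\<exists>F. abs_cont_on a b F \<and>
          (AE x\<in>{a<..<b} in lebesgue. F x = capillary_flux u hs x) \<and>
          (AE x\<in>{a<..<b} in lebesgue.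
             \<beta> / sqrt (1 + (deriv u x)\<^sup>2) * ((u x - hs x) / dt) = deriv F x))"

text \<open>
  \<open>hs n\<close> and \<open>ht (Suc n)\<close> are the rescaled profile and the unprojected capillary surface; both live
  on \<open>[a (Suc n), b (Suc n)]\<close>.  The values \<open>ht 0\<close> and \<open>hs N\<close> are not used.  The method
  presupposes that the droplet keeps a nonempty base, \<open>a n < b n\<close>, up to the final step.
\<close>

definition projection_method ::
  "real \<Rightarrow> real \<Rightarrow> real \<Rightarrow> nat \<Rightarrow> (nat \<Rightarrow> real) \<Rightarrow> (nat \<Rightarrow> real) \<Rightarrow>
   (nat \<Rightarrow> real \<Rightarrow> real) \<Rightarrow> (nat \<Rightarrow> real \<Rightarrow> real) \<Rightarrow> (nat \<Rightarrow> real \<Rightarrow> real) \<Rightarrow> bool" where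
  "projection_method \<sigma> \<beta> dt N a b h hs ht \<longleftrightarrow>
     (\<forall>n\<le>N. a n < b n) \<and>
     abs_cont_on (a 0) (b 0) (h 0) \<and> (\<forall>x\<in>{a 0..b 0}. 0 \<le> h 0 x) \<and>
     h 0 (a 0) = 0 \<and> h 0 (b 0) = 0 \<and>
     (\<forall>n<N.
        endpoint_update \<sigma> dt (a n) (b n) (h n) (a (Suc n)) (b (Suc n)) \<and>
        rescaled_profile (a n) (b n) (h n) (a (Suc n)) (b (Suc n)) (hs n) \<and>
        capillary_update \<beta> dt (a (Suc n)) (b (Suc n)) (hs n) (ht (Suc n)) \<and>
        (\<forall>x\<in>{a (Suc n)..b (Suc n)}. h (Suc n) x = max (ht (Suc n) x) 0))"

end

theory Submission
  imports Defs
begin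

text \<open>
  Testing the equation of Step 3 with \<open>w = u - v\<close>, where \<open>u\<close> is the unprojected surface and \<open>v\<close> the
  rescaled profile, turns the flux term into an exact difference of lengths, because
  \<open>(u'\<^sup>2 - v'\<^sup>2) / (sqrt (1 + u'\<^sup>2) + sqrt (1 + v'\<^sup>2)) = sqrt (1 + u'\<^sup>2) - sqrt (1 + v'\<^sup>2)\<close>.
  Hence length of \<open>u\<close> plus dissipation equals length of \<open>v\<close>.  The projection does not increase the
  length, and the rescaling increases it at most by the growth of the base, which is at most \<open>2 dt\<close>
  per step.  So at all times the length plus the accumulated dissipation is bounded by the initial
  length plus \<open>2 T\<close>, and the maximum and the sum can be estimated separately.

  The profiles and fluxes are only absolutely continuous.  Products, positive parts and rescalings
  stay in this class because a function that is differentiable almost everywhere and whose increments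
  are dominated by the integral of an integrable function satisfies the fundamental theorem of calculus.
\<close>

section \<open>Absolute continuity from dominated increments\<close>

lemma AE_on_iff_negligible:
  "(AE x\<in>A in lebesgue. P x) \<longleftrightarrow> (\<exists>N. negligible N \<and> (\<forall>x\<in>A - N. P x))"
  unfolding eventually_ae_filter_negligible by (intro ex_cong1) auto

text \<open>
  In the Riemann sums, intervals tagged in the exceptional null set \<open>E\<close> are controlled by the Henstock
  lemma for the dominating function, which may be set to \<open>0\<close> on \<open>E\<close>; the others by differentiability.
\<close>

lemma has_integral_deriv_dominated:
  fixes f \<phi> :: "real \<Rightarrow> real"
  assumes "a \<le> b" and \<phi>: "\<phi> integrable_on {a..b}"
    and dom: "\<And>x y. a \<le> x \<Longrightarrow> x \<le> y \<Longrightarrow> y \<le> b \<Longrightarrow> \<bar>f y - f x\<bar> \<le> integral {x..y} \<phi>"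
    and diff: "AE x\<in>{a<..<b} in lebesgue. f differentiable (at x)"
  shows "(deriv f has_integral (f b - f a)) {a..b}"
proof -
  obtain N where "negligible N" and N: "\<And>x. x \<in> {a<..<b} - N \<Longrightarrow> f differentiable (at x)"
    using diff unfolding AE_on_iff_negligible by auto
  define E where "E = N \<union> {a, b}"
  have E: "negligible E"
    using \<open>negligible N\<close> by (simp add: E_def)
  define g where "g x = (if x \<in> E then 0 else deriv f x)" for x
  define \<psi> where "\<psi> x = (if x \<in> E then 0 else \<phi> x)" for x
  have \<psi>: "\<psi> integrable_on cbox a b"
    using integrable_spike[OF \<phi> E] by (auto simp: \<psi>_def)
  have int_\<psi>: "integral {x..y} \<psi> = integral {x..y} \<phi>" for x y
    by (rule integral_spike[OF E]) (auto simp: \<psi>_def)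
  have "(g has_integral (f b - f a)) (cbox a b)"
    unfolding has_integral
  proof (intro allI impI)
    fix e :: real
    assume "0 < e"
    \<comment> \<open>The linear errors add up to \<open>\<epsilon> * (b - a)\<close>, which is to
      stay below \<open>e / 2\<close>; the \<open>+ 1\<close> keeps the denominator positive when
      \<open>a = b\<close>.\<close>
    define \<epsilon> where "\<epsilon> = e / (2 * (b - a + 1))"
    have "0 < \<epsilon>"
      using \<open>0 < e\<close> \<open>a \<le> b\<close> by (simp add: \<epsilon>_def)
    have "\<epsilon> * (b - a) \<le> e / 2"
      using \<open>0 < e\<close> \<open>a \<le> b\<close> by (simp add: \<epsilon>_def field_simps)
    obtain \<gamma> where \<gamma>: "gauge \<gamma>"
      and H: "\<And>p. p tagged_partial_division_of (cbox a b) \<Longrightarrow> \<gamma> fine p \<Longrightarrow>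
                (\<Sum>(x,K)\<in>p. norm (measure lborel K *\<^sub>R \<psi> x - integral K \<psi>)) < e / 2"
      using Henstock_lemma[OF \<psi>, of "e / 2"] \<open>0 < e\<close> by auto
    \<comment> \<open>The implication stands under the quantifier so that a radius exists for every
      \<open>x\<close>; this makes \<open>d\<close> total, as a gauge must be. At points outside
      \<open>{a..b} - E\<close> any radius serves.\<close>
    have "\<exists>d>0. x \<in> {a..b} - E \<longrightarrow>
            (\<forall>y. \<bar>y - x\<bar> < d \<longrightarrow> \<bar>f y - f x - (y - x) * g x\<bar> \<le> \<epsilon> * \<bar>y - x\<bar>)" for x
    proof (cases "x \<in> {a..b} - E")
      case True
      then have "f differentiable (at x)"
        using N[of x] by (auto simp: E_def less_le)
      then have "(f has_derivative (\<lambda>h. g x * h)) (at x)"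
        using True by (simp add: g_def DERIV_deriv_iff_real_differentiable
            flip: has_field_derivative_def)
      then show ?thesis
        using \<open>0 < \<epsilon>\<close> unfolding has_derivative_at_alt by (force simp: mult.commute)
    qed (auto intro: exI[of _ 1])
    then obtain d where d0: "\<And>x. 0 < d x"
      and d: "\<And>x y. x \<in> {a..b} - E \<Longrightarrow> \<bar>y - x\<bar> < d x \<Longrightarrow>
                \<bar>f y - f x - (y - x) * g x\<bar> \<le> \<epsilon> * \<bar>y - x\<bar>"
      by metis
    show "\<exists>\<gamma>'. gauge \<gamma>' \<and> (\<forall>p. p tagged_division_of (cbox a b) \<and> \<gamma>' fine p \<longrightarrow>
            norm ((\<Sum>(x,K)\<in>p. measure lborel K *\<^sub>R g x) - (f b - f a)) < e)"
    proof (intro exI conjI allI impI; (elim conjE)?)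
      show "gauge (\<lambda>x. \<gamma> x \<inter> ball x (d x))"
        using \<gamma> d0 by (intro gauge_Int gauge_ball_dependent) auto
    next
      fix p
      assume p: "p tagged_division_of (cbox a b)" and fine: "(\<lambda>x. \<gamma> x \<inter> ball x (d x)) fine p"
      have tele: "b - a = (\<Sum>(x,K)\<in>p. Sup K - Inf K)" "f b - f a = (\<Sum>(x,K)\<in>p. f (Sup K) - f (Inf K))"
        using additive_tagged_division_1[where f = "\<lambda>x. x"] additive_tagged_division_1[where f = f]
          \<open>a \<le> b\<close> p by auto
      have "norm (\<Sum>(x,K)\<in>p. measure lborel K *\<^sub>R g x - (f (Sup K) - f (Inf K)))
          \<le> (\<Sum>(x,K)\<in>p. \<epsilon> * (Sup K - Inf K) + norm (measure lborel K *\<^sub>R \<psi> x - integral K \<psi>))"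
      proof (rule sum_norm_le, safe)
        fix x K
        assume "(x, K) \<in> p"
        then have "x \<in> K" "K \<subseteq> cbox a b"
          using p by blast+
        then obtain u v where K: "K = {u..v}"
          using p \<open>(x, K) \<in> p\<close> by auto
        have uv: "a \<le> u" "u \<le> x" "x \<le> v" "v \<le> b" "u \<le> v"
          using \<open>x \<in> K\<close> \<open>K \<subseteq> cbox a b\<close> by (auto simp: K)
        have near: "\<bar>y - x\<bar> < d x" if "y \<in> K" for y
          using fine that \<open>(x, K) \<in> p\<close> by (force simp: fine_def dist_real_def)
        show "norm (measure lborel K *\<^sub>R g x - (f (Sup K) - f (Inf K)))
          \<le> \<epsilon> * (Sup K - Inf K) + norm (measure lborel K *\<^sub>R \<psi> x - integral K \<psi>)"
        proof (cases "x \<in> E")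
          case True
          then have "norm (measure lborel K *\<^sub>R g x - (f (Sup K) - f (Inf K))) = \<bar>f v - f u\<bar>"
            using uv by (simp add: K g_def)
          \<comment> \<open>Since \<open>\<psi> x = 0\<close> here, the Henstock term is the
            absolute value of the integral of \<open>\<phi>\<close> over \<open>K\<close>, and this
            bounds the increment of \<open>f\<close>.\<close>
          also have "\<dots> \<le> norm (measure lborel K *\<^sub>R \<psi> x - integral K \<psi>)"
            using dom[of u v] uv True by (simp add: K int_\<psi> \<psi>_def)
          finally show ?thesis
            using \<open>0 < \<epsilon>\<close> uv by (simp add: K add_increasing)
        next
          case False
          \<comment> \<open>Straddling: the tag lies between \<open>u\<close> and \<open>v\<close>,
            so the two linearization errors add up to \<open>\<epsilon> * (v - u)\<close>.\<close>
          have "\<bar>f v - f x - (v - x) * g x\<bar> \<le> \<epsilon> * (v - x)" "\<bar>f u - f x - (u - x) * g x\<bar> \<le> \<epsilon> * (x - u)"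
            using d[of x v] d[of x u] near[of u] near[of v] uv False by (auto simp: K)
          then have "\<bar>(v - u) * g x - (f v - f u)\<bar> \<le> \<epsilon> * (v - u)"
            by (simp add: algebra_simps abs_le_iff)
          then show ?thesis
            using uv by (simp add: K add_increasing2)
        qed
      qed
      also have "\<dots> = \<epsilon> * (b - a) + (\<Sum>(x,K)\<in>p. norm (measure lborel K *\<^sub>R \<psi> x - integral K \<psi>))"
        by (simp add: tele(1) split_def sum.distrib sum_distrib_left)
      also have "\<dots> < e / 2 + e / 2"
        using p fine \<open>\<epsilon> * (b - a) \<le> e / 2\<close>
        by (intro add_le_less_mono H) (auto simp: fine_def tagged_division_of_def)
      finally show "norm ((\<Sum>(x,K)\<in>p. measure lborel K *\<^sub>R g x) - (f b - f a)) < e"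
        by (simp add: tele(2) split_def flip: sum_subtractf)
    qed
  qed
  then show ?thesis
    by (intro has_integral_spike[OF E, of "{a..b}" "deriv f" g]) (auto simp: g_def)
qed

text \<open>The previous lemma applies on every subinterval, so each integral of
  \<open>deriv f\<close> is an increment of \<open>f\<close> and is dominated by the integral of
  \<open>\<phi>\<close>. The indefinite integral of \<open>deriv f\<close> thus has bounded
  variation, which upgrades integrability to absolute integrability. This is the tool for
  differences, products, positive parts and rescalings.\<close>

lemma abs_cont_on_dominated:
  fixes f \<phi> :: "real \<Rightarrow> real"
  assumes "a \<le> b" and \<phi>: "\<phi> integrable_on {a..b}"
    and dom: "\<And>x y. a \<le> x \<Longrightarrow> x \<le> y \<Longrightarrow> y \<le> b \<Longrightarrow> \<bar>f y - f x\<bar> \<le> integral {x..y} \<phi>"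
    and diff: "AE x\<in>{a<..<b} in lebesgue. f differentiable (at x)"
  shows "abs_cont_on a b f"
proof -
  have ftc: "(deriv f has_integral (f y - f x)) {x..y}" if "a \<le> x" "x \<le> y" "y \<le> b" for x y
  proof (rule has_integral_deriv_dominated)
    show "\<phi> integrable_on {x..y}"
      by (rule integrable_on_subinterval[OF \<phi>]) (use that in auto)
    show "AE t\<in>{x<..<y} in lebesgue. f differentiable (at t)"
      using diff by eventually_elim (use that in auto)
  qed (use that dom in auto)
  have "deriv f absolutely_integrable_on cbox a b"
  proof (rule bounded_variation_absolutely_integrable_interval)
    show "deriv f integrable_on cbox a b"
      using ftc[of a b] \<open>a \<le> b\<close> by auto
  next
    fix d
    assume d: "d division_of (cbox a b)"
    \<comment> \<open>The integral of \<open>\<phi>\<close> over the whole interval is the uniform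
      bound on the variation over all divisions.\<close>
    have "(\<Sum>K\<in>d. norm (integral K (deriv f))) \<le> (\<Sum>K\<in>d. integral K \<phi>)"
    proof (rule sum_mono)
      fix K
      assume "K \<in> d"
      then obtain u v where "K = {u..v}" "u \<le> v" "a \<le> u" "v \<le> b"
        using division_ofD(2,3,4)[OF d] by (metis atLeastatMost_empty_iff2 atLeastatMost_subset_iff box_real(2))
      then show "norm (integral K (deriv f)) \<le> integral K \<phi>"
        using ftc[of u v] dom[of u v] by (simp add: integral_unique)
    qed
    also have "\<dots> = integral (cbox a b) \<phi>"
      using \<phi> d by (simp add: integral_combine_division_topdown)
    finally show "(\<Sum>K\<in>d. norm (integral K (deriv f))) \<le> integral (cbox a b) \<phi>" .
  qed
  moreover have "f x = f a + integral {a..x} (deriv f)" if "x \<in> {a..b}" for x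
    using ftc[of a x] that by (simp add: integral_unique)
  ultimately show ?thesis
    using diff unfolding abs_cont_on_def box_real by blast
qed

section \<open>Almost-everywhere arguments and the calculus of absolutely continuous
  functions\<close>

lemma AE_Ioo_obtain_negligible:
  fixes a b :: real
  assumes "AE x\<in>{a<..<b} in lebesgue. P x"
  obtains N where "negligible N" "\<And>x. x \<in> {a..b} - N \<Longrightarrow> P x"
proof -
  obtain N where "negligible N" "\<forall>x\<in>{a<..<b} - N. P x"
    using assms unfolding AE_on_iff_negligible by auto
  then show thesis
    \<comment> \<open>Adding the two endpoints to the null set makes the property available for
      integrals over the closed interval.\<close>
    by (intro that[of "N \<union> {a, b}"]) (auto simp: less_le)
qed

lemma integral_mono_AE_Ioo:
  fixes f g :: "real \<Rightarrow> real"
  assumes "f integrable_on {a..b}" "g integrable_on {a..b}"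
    and "AE x\<in>{a<..<b} in lebesgue. f x \<le> g x"
  shows "integral {a..b} f \<le> integral {a..b} g"
proof -
  obtain N where N: "negligible N" "\<And>x. x \<in> {a..b} - N \<Longrightarrow> f x \<le> g x"
    using AE_Ioo_obtain_negligible[OF assms(3)] by blast
  \<comment> \<open>Replacing \<open>f\<close> by \<open>g\<close> on the null set turns the
    comparison into one that holds at every point.\<close>
  let ?f = "\<lambda>x. if x \<in> N then g x else f x"
  have "integral {a..b} f = integral {a..b} ?f"
    by (rule integral_spike[OF N(1)]) auto
  also have "\<dots> \<le> integral {a..b} g"
  proof (rule integral_le)
    show "?f integrable_on {a..b}"
      using integrable_spike[OF assms(1) N(1), of ?f] by simp
  qed (use N assms in auto)
  finally show ?thesis .
qed

lemma has_integral_cong_AE_Ioo: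
  fixes f g :: "real \<Rightarrow> real"
  assumes "(f has_integral i) {a..b}"
    and "AE x\<in>{a<..<b} in lebesgue. g x = f x"
  shows "(g has_integral i) {a..b}"
  using AE_Ioo_obtain_negligible[OF assms(2)] has_integral_spike[OF _ _ assms(1)] by metis

lemma abs_cont_on_AE_differentiable:
  "abs_cont_on a b f \<Longrightarrow> AE x\<in>{a<..<b} in lebesgue. f differentiable (at x)"
  unfolding abs_cont_on_def by blast

lemma abs_cont_on_integrable:
  assumes "abs_cont_on a b f" "a \<le> x" "y \<le> b"
  shows "deriv f absolutely_integrable_on {x..y}"
    and "deriv f integrable_on {x..y}"
    and "(\<lambda>t. \<bar>deriv f t\<bar>) integrable_on {x..y}"
proof -
  show *: "deriv f absolutely_integrable_on {x..y}"
    by (rule absolutely_integrable_on_subinterval[of "{a..b}"]) (use assms in \<open>auto simp only: abs_cont_on_def atLeastatMost_subset_iff\<close>)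
  show "deriv f integrable_on {x..y}" "(\<lambda>t. \<bar>deriv f t\<bar>) integrable_on {x..y}"
    using * by (simp_all add: absolutely_integrable_on_def)
qed

lemma abs_cont_on_diff_eq:
  assumes f: "abs_cont_on a b f" and xy: "a \<le> x" "x \<le> y" "y \<le> b"
  shows "f y - f x = integral {x..y} (deriv f)"
proof -
  have "integral {a..x} (deriv f) + integral {x..y} (deriv f) = integral {a..y} (deriv f)"
    using xy by (intro Henstock_Kurzweil_Integration.integral_combine abs_cont_on_integrable[OF f]) auto
  moreover have "f x = f a + integral {a..x} (deriv f)" "f y = f a + integral {a..y} (deriv f)"
    using f xy unfolding abs_cont_on_def by (meson atLeastAtMost_iff order_trans)+
  ultimately show ?thesis
    by linarith
qed

lemma abs_cont_on_diff_le:
  assumes f: "abs_cont_on a b f" and xy: "a \<le> x" "x \<le> y" "y \<le> b"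
  shows "\<bar>f y - f x\<bar> \<le> integral {x..y} (\<lambda>t. \<bar>deriv f t\<bar>)"
  using integral_norm_bound_integral[of "deriv f" "{x..y}" "\<lambda>t. \<bar>deriv f t\<bar>"]
    abs_cont_on_integrable[OF f, of x y] xy
  by (simp add: abs_cont_on_diff_eq[OF f xy])

lemma abs_cont_on_imp_continuous_on:
  assumes "abs_cont_on a b f"
  shows "continuous_on {a..b} f"
proof -
  have "continuous_on {a..b} (\<lambda>x. f a + integral {a..x} (deriv f))"
    using abs_cont_on_integrable[OF assms, of a b]
    by (intro continuous_intros indefinite_integral_continuous_1) auto
  then show ?thesis
    by (rule continuous_on_eq) (metis assms abs_cont_on_def)
qed

lemma abs_cont_on_bounded:
  assumes "abs_cont_on a b f"
  obtains B where "0 < B" "\<And>x. x \<in> {a..b} \<Longrightarrow> \<bar>f x\<bar> \<le> B"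
proof -
  have "bounded (f ` {a..b})"
    by (intro compact_imp_bounded compact_continuous_image abs_cont_on_imp_continuous_on assms) auto
  then show ?thesis
    using that by (auto simp: bounded_pos)
qed

lemma abs_cont_on_diff:
  assumes "a \<le> b" and f: "abs_cont_on a b f" and g: "abs_cont_on a b g"
  shows "abs_cont_on a b (\<lambda>x. f x - g x)"
proof (rule abs_cont_on_dominated)
  show "(\<lambda>t. \<bar>deriv f t\<bar> + \<bar>deriv g t\<bar>) integrable_on {a..b}"
    by (intro integrable_add abs_cont_on_integrable[OF f] abs_cont_on_integrable[OF g]) auto
next
  fix x y
  assume xy: "a \<le> x" "x \<le> y" "y \<le> b"
  have "integral {x..y} (\<lambda>t. \<bar>deriv f t\<bar> + \<bar>deriv g t\<bar>)
      = integral {x..y} (\<lambda>t. \<bar>deriv f t\<bar>) + integral {x..y} (\<lambda>t. \<bar>deriv g t\<bar>)"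
    using xy by (intro integral_add abs_cont_on_integrable[OF f] abs_cont_on_integrable[OF g])
  then show "\<bar>(f y - g y) - (f x - g x)\<bar> \<le> integral {x..y} (\<lambda>t. \<bar>deriv f t\<bar> + \<bar>deriv g t\<bar>)"
    using abs_cont_on_diff_le[OF f xy] abs_cont_on_diff_le[OF g xy] by linarith
next
  have "AE x\<in>{a<..<b} in lebesgue. f differentiable (at x)" "AE x\<in>{a<..<b} in lebesgue. g differentiable (at x)"
    by (rule abs_cont_on_AE_differentiable, fact)+
  then show "AE x\<in>{a<..<b} in lebesgue. (\<lambda>x. f x - g x) differentiable (at x)"
    by eventually_elim auto
qed fact

lemma abs_cont_on_mult:
  assumes "a \<le> b" and f: "abs_cont_on a b f" and g: "abs_cont_on a b g"
  shows "abs_cont_on a b (\<lambda>x. f x * g x)"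
proof -
  obtain A where A: "0 < A" "\<And>x. x \<in> {a..b} \<Longrightarrow> \<bar>f x\<bar> \<le> A"
    using abs_cont_on_bounded[OF f] by blast
  obtain B where B: "0 < B" "\<And>x. x \<in> {a..b} \<Longrightarrow> \<bar>g x\<bar> \<le> B"
    using abs_cont_on_bounded[OF g] by blast
  note int = abs_cont_on_integrable[OF f] abs_cont_on_integrable[OF g]
  show ?thesis
  proof (rule abs_cont_on_dominated)
    show "(\<lambda>t. B * \<bar>deriv f t\<bar> + A * \<bar>deriv g t\<bar>) integrable_on {a..b}"
      by (intro integrable_add integrable_on_mult_right int) auto
  next
    fix x y
    assume xy: "a \<le> x" "x \<le> y" "y \<le> b"
    have "f y * g y - f x * g x = g x * (f y - f x) + f y * (g y - g x)"
      by (simp add: algebra_simps)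
    also have "\<bar>\<dots>\<bar> \<le> B * \<bar>f y - f x\<bar> + A * \<bar>g y - g x\<bar>"
      using xy A(2)[of y] B(2)[of x]
      by (intro order_trans[OF abs_triangle_ineq]) (auto simp: abs_mult intro!: add_mono mult_right_mono)
    also have "\<dots> \<le> B * integral {x..y} (\<lambda>t. \<bar>deriv f t\<bar>) + A * integral {x..y} (\<lambda>t. \<bar>deriv g t\<bar>)"
      using xy A B by (intro add_mono mult_left_mono abs_cont_on_diff_le[OF f] abs_cont_on_diff_le[OF g]) auto
    also have "\<dots> = integral {x..y} (\<lambda>t. B * \<bar>deriv f t\<bar> + A * \<bar>deriv g t\<bar>)"
      using xy by (subst integral_add) (auto intro!: integrable_on_mult_right int)
    finally show "\<bar>f y * g y - f x * g x\<bar> \<le> integral {x..y} (\<lambda>t. B * \<bar>deriv f t\<bar> + A * \<bar>deriv g t\<bar>)" .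
  next
    have "AE x\<in>{a<..<b} in lebesgue. f differentiable (at x)" "AE x\<in>{a<..<b} in lebesgue. g differentiable (at x)"
      by (rule abs_cont_on_AE_differentiable, fact)+
    then show "AE x\<in>{a<..<b} in lebesgue. (\<lambda>x. f x * g x) differentiable (at x)"
      by eventually_elim auto
  qed fact
qed

section \<open>Length of a graph and its behaviour under the projection\<close>

definition graph_length :: "real \<Rightarrow> real \<Rightarrow> (real \<Rightarrow> real) \<Rightarrow> real" where
  "graph_length a b f = integral {a..b} (\<lambda>x. sqrt (1 + (deriv f x)\<^sup>2))"

lemma abs_cont_on_imp_graph_integrable:
  assumes "abs_cont_on a b f"
  shows "(\<lambda>x. sqrt (1 + (deriv f x)\<^sup>2)) integrable_on {a..b}"
proof (rule measurable_bounded_by_integrable_imp_integrable)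
  note int = abs_cont_on_integrable[OF assms, of a b]
  have "deriv f \<in> borel_measurable (lebesgue_on {a..b})"
    using int by (intro integrable_imp_measurable) auto
  then show "(\<lambda>x. sqrt (1 + (deriv f x)\<^sup>2)) \<in> borel_measurable (lebesgue_on {a..b})"
    by measurable
  show "(\<lambda>x. 1 + \<bar>deriv f x\<bar>) integrable_on {a..b}"
    using int by (intro integrable_add) auto
  show "norm (sqrt (1 + (deriv f x)\<^sup>2)) \<le> 1 + \<bar>deriv f x\<bar>" for x
    using sqrt_add_le_add_sqrt[of 1 "(deriv f x)\<^sup>2"] by simp
qed auto

text \<open>Near a point with \<open>u x \<noteq> 0\<close> the function \<open>h\<close> coincides
  with \<open>u\<close> or with \<open>0\<close>. At a zero of \<open>u\<close> the positive part
  would have a kink if the slope were nonzero; the last assumption excludes this case.\<close>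

lemma pos_part_differentiable:
  fixes u h :: "real \<Rightarrow> real"
  assumes h: "\<And>x. x \<in> {a..b} \<Longrightarrow> h x = max (u x) 0"
    and x: "x \<in> {a<..<b}" and u: "u differentiable (at x)"
    and zero: "u x = 0 \<Longrightarrow> deriv u x = 0"
  shows "h differentiable (at x)" and "\<bar>deriv h x\<bar> \<le> \<bar>deriv u x\<bar>"
proof -
  have Du: "(u has_real_derivative deriv u x) (at x)"
    using u by (simp add: DERIV_deriv_iff_real_differentiable)
  have cont: "isCont u x"
    using Du by (rule DERIV_isCont)
  have nhd: "eventually (\<lambda>y. y \<in> {a<..<b}) (nhds x)"
    using x by (intro eventually_nhds_in_open) auto
  have "\<exists>D. (h has_real_derivative D) (at x) \<and> \<bar>D\<bar> \<le> \<bar>deriv u x\<bar>"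
  proof (cases "u x" "0 :: real" rule: linorder_cases)
    case greater
    have "eventually (\<lambda>y. u y > 0) (nhds x)"
      using order_tendstoD(1)[OF cont[unfolded isCont_def tendsto_at_iff_tendsto_nhds] greater] .
    with nhd have "eventually (\<lambda>y. u y = h y) (nhds x)"
      by eventually_elim (auto simp: h)
    then have "(h has_real_derivative deriv u x) (at x)"
      using Du DERIV_cong_ev[OF refl _ refl] by blast
    then show ?thesis
      by blast
  next
    case less
    have "eventually (\<lambda>y. u y < 0) (nhds x)"
      using order_tendstoD(2)[OF cont[unfolded isCont_def tendsto_at_iff_tendsto_nhds] less] .
    with nhd have "eventually (\<lambda>y. 0 = h y) (nhds x)"
      by eventually_elim (auto simp: h)
    then have "(h has_real_derivative 0) (at x)"
      using DERIV_cong_ev[OF refl _ refl, of "\<lambda>_. 0" h x 0] by simp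
    then show ?thesis
      by (intro exI[of _ 0]) auto
  next
    case equal
    with zero have "((\<lambda>y. (u y - u x) / (y - x)) \<longlongrightarrow> 0) (at x)"
      using Du by (simp add: has_field_derivative_iff)
    \<comment> \<open>Taking the positive part is 1-Lipschitz, so the difference quotients of
      \<open>h\<close> are squeezed by those of \<open>u\<close>, which tend to
      \<open>0\<close>.\<close>
    then have "((\<lambda>y. (h y - h x) / (y - x)) \<longlongrightarrow> 0) (at x)"
    proof (rule Lim_null_comparison[OF _ tendsto_rabs_zero, rotated])
      have "eventually (\<lambda>y. y \<in> {a<..<b}) (at x)"
        using nhd by (simp add: eventually_nhds_conv_at)
      then show "\<forall>\<^sub>F y in at x. norm ((h y - h x) / (y - x)) \<le> \<bar>(u y - u x) / (y - x)\<bar>"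
        by eventually_elim (use x equal in \<open>auto simp: h abs_divide intro!: divide_right_mono\<close>)
    qed
    then show ?thesis
      by (intro exI[of _ 0]) (auto simp: has_field_derivative_iff)
  qed
  then obtain D where D: "(h has_real_derivative D) (at x)" "\<bar>D\<bar> \<le> \<bar>deriv u x\<bar>"
    by blast
  show "h differentiable (at x)"
    using D(1) by (auto simp: real_differentiable_def)
  show "\<bar>deriv h x\<bar> \<le> \<bar>deriv u x\<bar>"
    using D by (simp add: DERIV_imp_deriv)
qed

lemma AE_pos_part:
  fixes u h :: "real \<Rightarrow> real"
  assumes h: "\<And>x. x \<in> {a..b} \<Longrightarrow> h x = max (u x) 0"
    and u: "AE x\<in>{a<..<b} in lebesgue. u differentiable (at x)"
  shows "AE x\<in>{a<..<b} in lebesgue. h differentiable (at x) \<and> \<bar>deriv h x\<bar> \<le> \<bar>deriv u x\<bar>"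
proof -
  \<comment> \<open>The only bad points are the zeros of \<open>u\<close> with nonzero slope.\<close>
  define S where "S = {x. u differentiable (at x) \<and> deriv u x \<noteq> 0}"
  \<comment> \<open>The preimage of the null set \<open>{0}\<close> under a map with injective
    derivative is again a null set.\<close>
  have "negligible {x \<in> S. u x \<in> {0}}"
  proof (rule negligible_differentiable_vimage)
    fix x
    assume "x \<in> S"
    then have "(u has_real_derivative deriv u x) (at x)"
      by (simp add: S_def DERIV_deriv_iff_real_differentiable)
    then show "(u has_derivative (*) (deriv u x)) (at x within S)"
      by (simp add: has_field_derivative_def has_derivative_at_withinI)
    show "inj ((*) (deriv u x))"
      using \<open>x \<in> S\<close> by (auto simp: S_def inj_on_def)
  qed auto
  then have "AE x in lebesgue. x \<in> S \<longrightarrow> u x \<noteq> 0"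
    unfolding eventually_ae_filter_negligible by auto
  with u show ?thesis
    by eventually_elim (use pos_part_differentiable[of a b h u] h in \<open>auto simp: S_def\<close>)
qed

text \<open>The increments of \<open>h\<close> are at most those of \<open>u\<close>, so
  \<open>\<bar>deriv u t\<bar>\<close> serves as dominating function. Almost everywhere the slope of
  \<open>h\<close> is no steeper than that of \<open>u\<close>, whence the comparison of
  lengths.\<close>

lemma abs_cont_on_pos_part:
  fixes u h :: "real \<Rightarrow> real"
  assumes "a \<le> b" and u: "abs_cont_on a b u" and h: "\<And>x. x \<in> {a..b} \<Longrightarrow> h x = max (u x) 0"
  shows "abs_cont_on a b h" and "graph_length a b h \<le> graph_length a b u"
proof -
  have ae: "AE x\<in>{a<..<b} in lebesgue. h differentiable (at x) \<and> \<bar>deriv h x\<bar> \<le> \<bar>deriv u x\<bar>"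
    by (rule AE_pos_part[OF h abs_cont_on_AE_differentiable[OF u]])
  show ac: "abs_cont_on a b h"
  proof (rule abs_cont_on_dominated)
    show "(\<lambda>t. \<bar>deriv u t\<bar>) integrable_on {a..b}"
      by (rule abs_cont_on_integrable[OF u]) auto
    show "AE x\<in>{a<..<b} in lebesgue. h differentiable (at x)"
      using ae by eventually_elim auto
    show "\<bar>h y - h x\<bar> \<le> integral {x..y} (\<lambda>t. \<bar>deriv u t\<bar>)" if "a \<le> x" "x \<le> y" "y \<le> b" for x y
      using abs_cont_on_diff_le[OF u that] that by (auto simp: h)
  qed fact
  show "graph_length a b h \<le> graph_length a b u"
    unfolding graph_length_def
  proof (rule integral_mono_AE_Ioo)
    show "AE x\<in>{a<..<b} in lebesgue. sqrt (1 + (deriv h x)\<^sup>2) \<le> sqrt (1 + (deriv u x)\<^sup>2)"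
      using ae by eventually_elim (simp add: abs_le_square_iff)
  qed (intro abs_cont_on_imp_graph_integrable ac u)+
qed

section \<open>Rescaling to the new base\<close>

lemma AE_Ioo_affine:
  fixes r c :: real
  assumes "AE x\<in>{r * a + c<..<r * b + c} in lebesgue. P x" and "0 < r"
  shows "AE x\<in>{a<..<b} in lebesgue. P (r * x + c)"
proof -
  obtain N where N: "negligible N" "\<And>x. x \<in> {r * a + c<..<r * b + c} - N \<Longrightarrow> P x"
    using assms(1) unfolding AE_on_iff_negligible by auto
  have "negligible {x \<in> UNIV. r * x + c \<in> N}"
  proof (rule negligible_differentiable_vimage[OF N(1)])
    show "((\<lambda>x. r * x + c) has_derivative (*) r) (at x within UNIV)" for x
      by (auto intro!: derivative_eq_intros)
    show "inj ((*) r)"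
      using \<open>0 < r\<close> by (auto simp: inj_on_def)
  qed
  then show ?thesis
    using N(2) \<open>0 < r\<close> unfolding AE_on_iff_negligible
    by (intro exI[of _ "{x \<in> UNIV. r * x + c \<in> N}"]) auto
qed

lemma has_integral_affine_Icc:
  fixes f :: "real \<Rightarrow> real"
  assumes "f integrable_on {r * x + c..r * y + c}" and "0 < r"
  shows "((\<lambda>t. r * f (r * t + c)) has_integral integral {r * x + c..r * y + c} f) {x..y}"
proof -
  have "((\<lambda>t. f (r * t + c)) has_integral (integral {r * x + c..r * y + c} f / r)) {x..y}"
    using has_integral_affinity'[OF _ \<open>0 < r\<close>, of f "integral {r * x + c..r * y + c} f" "r * x + c" "r * y + c" c]
      assms integrable_integral[OF assms(1)]
    by (simp add: divide_inverse_commute flip: mult.assoc)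
  from has_integral_mult_right[OF this, of r] show ?thesis
    using \<open>0 < r\<close> by simp
qed

text \<open>For \<open>r \<le> 1\<close> this is the triangle inequality for the plane vectors
  \<open>(1, r * p) = r * (1, p) + (1 - r, 0)\<close>; for \<open>r \<ge> 1\<close> the first
  summand alone suffices.\<close>

lemma sqrt_stretch_le:
  fixes r p :: real
  assumes "0 < r"
  shows "sqrt (1 + (r * p)\<^sup>2) \<le> r * sqrt (1 + p\<^sup>2) + max 0 (1 - r)"
proof -
  let ?A = "r * sqrt (1 + p\<^sup>2)" and ?m = "max 0 (1 - r)"
  have A: "r \<le> ?A" "?A\<^sup>2 = r\<^sup>2 + (r * p)\<^sup>2"
    using assms by (simp_all add: power_mult_distrib algebra_simps)
  \<comment> \<open>The right-hand side is \<open>(r + ?m)\<^sup>2\<close>, and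
    \<open>r + ?m\<close> is the maximum of \<open>r\<close> and \<open>1\<close>.\<close>
  have "1 \<le> r\<^sup>2 + 2 * r * ?m + ?m\<^sup>2"
  proof (cases "r \<le> 1")
    case True
    then have "r\<^sup>2 + 2 * r * ?m + ?m\<^sup>2 = 1"
      by (simp add: max_def power2_eq_square algebra_simps)
    then show ?thesis
      by simp
  qed (simp add: max_def one_le_power)
  also have "\<dots> \<le> r\<^sup>2 + 2 * ?A * ?m + ?m\<^sup>2"
    using A(1) by (simp add: mult_right_mono)
  finally have "1 + (r * p)\<^sup>2 \<le> (?A + ?m)\<^sup>2"
    using A(2) by (simp add: power2_sum)
  then show ?thesis
    using assms by (intro real_le_lsqrt) auto
qed

text \<open>On the new base \<open>hs\<close> is \<open>h\<close> composed with an affine map onto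
  the old base, so slopes are multiplied by the ratio \<open>r\<close> of old to new base length. In
  the estimate for the stretched length element, the main term integrates by substitution exactly to
  the old length, and the remainder to the growth of the base.\<close>

lemma rescaled_profile:
  assumes "rescaled_profile a b h a' b' hs" and "a < b" "a' < b'" and h: "abs_cont_on a b h"
  shows "abs_cont_on a' b' hs" and "hs a' = h a" and "hs b' = h b"
    and "graph_length a' b' hs \<le> graph_length a b h + max 0 ((b' - a') - (b - a))"
proof -
  define r where "r = (b - a) / (b' - a')"
  \<comment> \<open>With this shift the map sending \<open>x\<close> to \<open>r * x + c\<close>
    takes \<open>a'\<close> to \<open>a\<close> and \<open>b'\<close> to \<open>b\<close>.\<close>
  define c where "c = a - r * a'"
  have r: "0 < r" "r * (b' - a') = b - a"
    using assms by (simp_all add: r_def)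
  have ends: "r * a' + c = a" "r * b' + c = b"
    using r by (simp_all add: c_def algebra_simps)
  have hs: "hs x = h (r * x + c)" if "x \<in> {a'..b'}" for x
  proof -
    have "r * x + c \<in> {r * a' + c..r * b' + c}"
      using that r by simp
    moreover have "(r * x + c - a) / (b - a) = (x - a') / (b' - a')"
    proof -
      have "r * x + c - a = r * (x - a')"
        by (simp add: c_def algebra_simps)
      then show ?thesis
        using assms by (simp add: r_def)
    qed
    ultimately show ?thesis
      using assms that unfolding rescaled_profile_def ends by blast
  qed
  then show "hs a' = h a" "hs b' = h b"
    using assms by (simp_all add: ends)
  have D: "(hs has_real_derivative r * deriv h (r * x + c)) (at x)"
    if "x \<in> {a'<..<b'}" "h differentiable (at (r * x + c))" for x
  proof -
    have "((\<lambda>x. h (r * x + c)) has_real_derivative deriv h (r * x + c) * r) (at x)"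
      using that
      by (intro DERIV_chain2[where g = "\<lambda>x. r * x + c"])
        (auto simp: DERIV_deriv_iff_real_differentiable intro!: derivative_eq_intros)
    moreover have "eventually (\<lambda>y. y \<in> {a'<..<b'}) (nhds x)"
      using that by (intro eventually_nhds_in_open) auto
    then have "eventually (\<lambda>y. hs y = h (r * y + c)) (nhds x)"
      by eventually_elim (auto simp: hs)
    ultimately show ?thesis
      using DERIV_cong_ev[OF refl _ refl, of hs] by (simp add: mult.commute)
  qed
  have "AE x\<in>{a'<..<b'} in lebesgue. h differentiable (at (r * x + c))"
    by (rule AE_Ioo_affine) (use abs_cont_on_AE_differentiable[OF h] r in \<open>simp_all add: ends\<close>)
  then have ae: "AE x\<in>{a'<..<b'} in lebesgue. (hs has_real_derivative r * deriv h (r * x + c)) (at x)"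
    by eventually_elim (auto intro: D)
  have in_ab: "a \<le> r * x + c \<and> r * x + c \<le> r * y + c \<and> r * y + c \<le> b" if "a' \<le> x" "x \<le> y" "y \<le> b'" for x y
    using that r by (auto simp flip: ends)
  show ac: "abs_cont_on a' b' hs"
  proof (rule abs_cont_on_dominated)
    have int: "((\<lambda>t. r * \<bar>deriv h (r * t + c)\<bar>)
        has_integral integral {r * x + c..r * y + c} (\<lambda>t. \<bar>deriv h t\<bar>)) {x..y}"
      if "a' \<le> x" "x \<le> y" "y \<le> b'" for x y
      using in_ab[OF that] r by (intro has_integral_affine_Icc abs_cont_on_integrable[OF h]) auto
    show "(\<lambda>t. r * \<bar>deriv h (r * t + c)\<bar>) integrable_on {a'..b'}"
      using int[of a' b'] assms by auto
    show "\<bar>hs y - hs x\<bar> \<le> integral {x..y} (\<lambda>t. r * \<bar>deriv h (r * t + c)\<bar>)"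
      if "a' \<le> x" "x \<le> y" "y \<le> b'" for x y
      using abs_cont_on_diff_le[OF h, of "r * x + c" "r * y + c"] in_ab[OF that] that
      by (simp add: hs integral_unique[OF int[OF that]] del: integral_mult_right)
    show "AE x\<in>{a'<..<b'} in lebesgue. hs differentiable (at x)"
      using ae by eventually_elim (auto simp: real_differentiable_def)
  qed (use assms in auto)
  let ?g = "\<lambda>x. r * sqrt (1 + (deriv h (r * x + c))\<^sup>2)"
  have "(?g has_integral graph_length a b h) {a'..b'}"
    using has_integral_affine_Icc[of "\<lambda>x. sqrt (1 + (deriv h x)\<^sup>2)" r a' c b'] r
      abs_cont_on_imp_graph_integrable[OF h]
    by (simp add: ends graph_length_def)
  from has_integral_add[OF this has_integral_const_real[of "max 0 (1 - r)"]]
  have *: "((\<lambda>x. ?g x + max 0 (1 - r)) has_integral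
      graph_length a b h + (b' - a') * max 0 (1 - r)) {a'..b'}"
    using assms by simp
  have "graph_length a' b' hs \<le> integral {a'..b'} (\<lambda>x. ?g x + max 0 (1 - r))"
    unfolding graph_length_def
  proof (rule integral_mono_AE_Ioo)
    show "AE x\<in>{a'<..<b'} in lebesgue. sqrt (1 + (deriv hs x)\<^sup>2) \<le> ?g x + max 0 (1 - r)"
      using ae by eventually_elim (auto simp: DERIV_imp_deriv intro: sqrt_stretch_le[OF r(1)])
    show "(\<lambda>x. ?g x + max 0 (1 - r)) integrable_on {a'..b'}"
      using * by blast
  qed (intro abs_cont_on_imp_graph_integrable ac)
  also have "\<dots> = graph_length a b h + (b' - a') * max 0 (1 - r)"
    using * by (rule integral_unique)
  \<comment> \<open>The constant surplus \<open>max 0 (1 - r)\<close>, integrated over the new base,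
    is the positive part of the base growth because \<open>r * (b' - a') = b - a\<close>.\<close>
  also have "(b' - a') * max 0 (1 - r) = max 0 ((b' - a') - (b - a))"
  proof -
    have "(b' - a') * (1 - r) = (b' - a') - (b - a)"
      using r(2) by (simp add: algebra_simps)
    then show ?thesis
      using assms max_mult_distrib_left[of "b' - a'" 0 "1 - r"] by simp
  qed
  finally show "graph_length a' b' hs \<le> graph_length a b h + max 0 ((b' - a') - (b - a))" .
qed

section \<open>The energy identity of the capillary update\<close>

text \<open>An exact discrete chain rule: where the slopes differ, the symmetrized flux is the
  difference quotient of the length element between them.\<close>

lemma flux_mult_diff:
  "capillary_flux u v x * (deriv u x - deriv v x) = sqrt (1 + (deriv u x)\<^sup>2) - sqrt (1 + (deriv v x)\<^sup>2)"
proof -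
  let ?U = "sqrt (1 + (deriv u x)\<^sup>2)" and ?V = "sqrt (1 + (deriv v x)\<^sup>2)"
  have "(deriv u x + deriv v x) * (deriv u x - deriv v x) = ?U\<^sup>2 - ?V\<^sup>2"
    by (simp add: power2_eq_square algebra_simps)
  also have "\<dots> = (?U - ?V) * (?U + ?V)"
    by (simp add: power2_eq_square algebra_simps)
  moreover have "0 < ?U + ?V"
    by (intro add_pos_pos) (auto simp: add_pos_nonneg)
  ultimately show ?thesis
    by (simp add: capillary_flux_def field_simps)
qed

text \<open>The product of flux and test function is absolutely continuous and vanishes at both
  ends, so its derivative integrates to \<open>0\<close>. By the product rule, the equation and the
  discrete chain rule, this derivative is the dissipation density plus the difference of the length
  elements.\<close>

lemma capillary_update_energy:
  assumes upd: "capillary_update \<beta> dt a b v u" and "a \<le> b"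
    and v: "abs_cont_on a b v" "v a = 0" "v b = 0"
  shows "graph_length a b u
       + \<beta> / dt * integral {a..b} (\<lambda>x. \<bar>u x - v x\<bar>\<^sup>2 / sqrt (1 + (deriv u x)\<^sup>2))
       = graph_length a b v"
proof -
  obtain F where u: "abs_cont_on a b u" "u a = 0" "u b = 0" and F: "abs_cont_on a b F"
    and flux: "AE x\<in>{a<..<b} in lebesgue. F x = capillary_flux u v x"
    and eq: "AE x\<in>{a<..<b} in lebesgue. \<beta> / sqrt (1 + (deriv u x)\<^sup>2) * ((u x - v x) / dt) = deriv F x"
    using upd unfolding capillary_update_def by blast
  let ?w = "\<lambda>x. u x - v x"
  let ?U = "\<lambda>x. sqrt (1 + (deriv u x)\<^sup>2)" and ?V = "\<lambda>x. sqrt (1 + (deriv v x)\<^sup>2)"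
  let ?D = "\<lambda>x. \<beta> / dt * (\<bar>?w x\<bar>\<^sup>2 / ?U x)"
  have w: "abs_cont_on a b ?w"
    by (rule abs_cont_on_diff) fact+
  have Fw: "abs_cont_on a b (\<lambda>x. F x * ?w x)"
    by (rule abs_cont_on_mult) fact+
  \<comment> \<open>Integration by parts: the boundary terms vanish since \<open>u\<close> and
    \<open>v\<close> are both \<open>0\<close> at the endpoints.\<close>
  have "(deriv (\<lambda>x. F x * ?w x) has_integral 0) {a..b}"
    using abs_cont_on_diff_eq[OF Fw, of a b] abs_cont_on_integrable(2)[OF Fw, of a b] \<open>a \<le> b\<close> u v
    by (simp add: has_integral_iff)
  moreover have "AE x\<in>{a<..<b} in lebesgue. ?D x + (?U x - ?V x) = deriv (\<lambda>x. F x * ?w x) x"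
  proof -
    have "AE x\<in>{a<..<b} in lebesgue. u differentiable (at x)"
      "AE x\<in>{a<..<b} in lebesgue. v differentiable (at x)"
      "AE x\<in>{a<..<b} in lebesgue. F differentiable (at x)"
      by (rule abs_cont_on_AE_differentiable, fact)+
    with flux eq show ?thesis
    proof eventually_elim
      case (elim x)
      show ?case
      proof
        assume x: "x \<in> {a<..<b}"
        have "((\<lambda>x. F x * ?w x) has_real_derivative
            deriv F x * ?w x + (deriv u x - deriv v x) * F x) (at x)"
          using elim x
          by (intro DERIV_mult DERIV_diff) (auto simp: DERIV_deriv_iff_real_differentiable)
        then have "deriv (\<lambda>x. F x * ?w x) x = deriv F x * ?w x + F x * (deriv u x - deriv v x)"
          by (simp add: DERIV_imp_deriv mult.commute)
        also have "F x * (deriv u x - deriv v x) = ?U x - ?V x"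
          using elim x by (simp add: flux_mult_diff)
        also have "deriv F x * ?w x = ?D x"
          using elim x by (simp add: power2_eq_square mult_ac flip: elim(2))
        finally show "?D x + (?U x - ?V x) = deriv (\<lambda>x. F x * ?w x) x" ..
      qed
    qed
  qed
  ultimately have "((\<lambda>x. ?D x + (?U x - ?V x)) has_integral 0) {a..b}"
    by (rule has_integral_cong_AE_Ioo)
  moreover have "((\<lambda>x. ?U x - ?V x) has_integral graph_length a b u - graph_length a b v) {a..b}"
    unfolding graph_length_def
    by (intro has_integral_diff integrable_integral abs_cont_on_imp_graph_integrable u v)
  \<comment> \<open>Subtracting the integrable difference of length elements isolates the
    dissipation density and yields its integrability at the same time.\<close>
  ultimately have "((\<lambda>x. (?D x + (?U x - ?V x)) - (?U x - ?V x)) has_integral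
      0 - (graph_length a b u - graph_length a b v)) {a..b}"
    by (rule has_integral_diff)
  then have "integral {a..b} ?D = graph_length a b v - graph_length a b u"
    by (simp add: integral_unique del: integral_mult_right)
  moreover have "integral {a..b} ?D = \<beta> / dt * integral {a..b} (\<lambda>x. \<bar>?w x\<bar>\<^sup>2 / ?U x)"
    by (rule integral_mult_right)
  ultimately show ?thesis
    by linarith
qed

section \<open>One time step and its iteration\<close>

lemma endpoint_update_bounds:
  assumes "endpoint_update \<sigma> dt a b h a' b'" and "0 < dt"
  shows "a + \<sigma> * dt \<le> a'" "a' \<le> a + (1 + \<sigma>) * dt" "b - (1 + \<sigma>) * dt \<le> b'" "b' \<le> b - \<sigma> * dt"
proof -
  \<comment> \<open>This quantity is the cosine of the angle whose tangent is \<open>p\<close>, that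
    is, of the contact angle up to sign.\<close>
  have cos: "0 \<le> 1 / sqrt (1 + p\<^sup>2)" "1 / sqrt (1 + p\<^sup>2) \<le> 1" for p :: real
  proof -
    have "1 \<le> sqrt (1 + p\<^sup>2)"
      by simp
    then show "0 \<le> 1 / sqrt (1 + p\<^sup>2)" "1 / sqrt (1 + p\<^sup>2) \<le> 1"
      using zero_le_divide_1_iff[of "sqrt (1 + p\<^sup>2)"] divide_le_eq_1_pos[of "sqrt (1 + p\<^sup>2)" 1] by linarith+
  qed
  obtain p q where "(a' - a) / dt = \<sigma> + 1 / sqrt (1 + p\<^sup>2)" "(b' - b) / dt = - \<sigma> - 1 / sqrt (1 + q\<^sup>2)"
    using assms by (auto simp: endpoint_update_def)
  then have "\<sigma> \<le> (a' - a) / dt" "(a' - a) / dt \<le> 1 + \<sigma>" "- (1 + \<sigma>) \<le> (b' - b) / dt" "(b' - b) / dt \<le> - \<sigma>"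
    using cos[of p] cos[of q] by linarith+
  then show "a + \<sigma> * dt \<le> a'" "a' \<le> a + (1 + \<sigma>) * dt" "b - (1 + \<sigma>) * dt \<le> b'" "b' \<le> b - \<sigma> * dt"
    using \<open>0 < dt\<close> by (simp_all add: field_simps)
qed

text \<open>The case distinction covers integrands that are not integrable, for which the integral
  takes the default value \<open>0\<close>.\<close>

lemma graph_length_nonneg: "0 \<le> graph_length a b f"
  unfolding graph_length_def
  by (cases "(\<lambda>x. sqrt (1 + (deriv f x)\<^sup>2)) integrable_on {a..b}")
    (auto intro: integral_nonneg simp: not_integrable_integral)

definition dissipation :: "real \<Rightarrow> real \<Rightarrow> (real \<Rightarrow> real) \<Rightarrow> (real \<Rightarrow> real) \<Rightarrow> real" where
  "dissipation a b u v = integral {a..b} (\<lambda>x. \<bar>u x - v x\<bar>\<^sup>2 / sqrt (1 + (deriv u x)\<^sup>2))"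

lemma dissipation_nonneg: "0 \<le> dissipation a b u v"
  unfolding dissipation_def
  by (cases "(\<lambda>x. \<bar>u x - v x\<bar>\<^sup>2 / sqrt (1 + (deriv u x)\<^sup>2)) integrable_on {a..b}")
    (auto intro: integral_nonneg simp: not_integrable_integral)

text \<open>The energy is followed through the three stages: rescaling may add the base growth, the
  capillary update trades length for dissipation exactly, and the projection only shortens.\<close>

lemma projection_step:
  assumes upd_ends: "endpoint_update \<sigma> dt a b h a' b'"
    and resc: "rescaled_profile a b h a' b' hs"
    and upd: "capillary_update \<beta> dt a' b' hs u"
    and h': "\<And>x. x \<in> {a'..b'} \<Longrightarrow> h' x = max (u x) 0"
    and "a < b" "a' < b'" "0 < dt" "-1 < \<sigma>"
    and h: "abs_cont_on a b h" "h a = 0" "h b = 0"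
  shows "abs_cont_on a' b' h'" and "h' a' = 0" and "h' b' = 0"
    and "graph_length a' b' h' + \<beta> / dt * dissipation a' b' u hs \<le> graph_length a b h + 2 * dt"
proof -
  have u: "abs_cont_on a' b' u" "u a' = 0" "u b' = 0"
    using upd by (auto simp: capillary_update_def)
  note hs = rescaled_profile[OF resc \<open>a < b\<close> \<open>a' < b'\<close> h(1)]
  note h'_u = abs_cont_on_pos_part[OF less_imp_le[OF \<open>a' < b'\<close>] u(1) h']
  show "abs_cont_on a' b' h'"
    by (rule h'_u)
  show "h' a' = 0" "h' b' = 0"
    using h' u \<open>a' < b'\<close> by simp_all
  have "graph_length a' b' u + \<beta> / dt * dissipation a' b' u hs = graph_length a' b' hs"
    unfolding dissipation_def using capillary_update_energy[OF upd _ hs(1)] hs(2,3) h \<open>a' < b'\<close> by simp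
  moreover have "(b' - a') - (b - a) \<le> 2 * dt"
  proof -
    \<comment> \<open>Each endpoint moves outwards by at most \<open>- \<sigma> * dt\<close>, hence
      by at most \<open>dt\<close>, so the base grows by at most \<open>2 * dt\<close>.\<close>
    have "- \<sigma> * dt \<le> 1 * dt"
      using assms by (intro mult_right_mono) auto
    then show ?thesis
      using endpoint_update_bounds[OF upd_ends \<open>0 < dt\<close>] by linarith
  qed
  ultimately show "graph_length a' b' h' + \<beta> / dt * dissipation a' b' u hs \<le> graph_length a b h + 2 * dt"
    using hs(4) h'_u(2) \<open>0 < dt\<close> by linarith
qed

text \<open>The bounds are stated at the current time \<open>real n * dt\<close>, and length and
  accumulated dissipation are kept in one sum, so that the estimates of the single steps add
  up.\<close>

lemma projection_method_estimates:
  assumes pm: "projection_method \<sigma> \<beta> dt N a b h hs ht"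
    and "0 < dt" "-1 < \<sigma>" and "n \<le> N"
  shows "a 0 + \<sigma> * (real n * dt) \<le> a n" "a n \<le> a 0 + (1 + \<sigma>) * (real n * dt)"
    and "b 0 - (1 + \<sigma>) * (real n * dt) \<le> b n" "b n \<le> b 0 - \<sigma> * (real n * dt)"
    and "graph_length (a n) (b n) (h n)
        + \<beta> / dt * (\<Sum>k=0..<n. dissipation (a (Suc k)) (b (Suc k)) (ht (Suc k)) (hs k))
        \<le> graph_length (a 0) (b 0) (h 0) + 2 * (real n * dt)"
proof -
  have step: "endpoint_update \<sigma> dt (a n) (b n) (h n) (a (Suc n)) (b (Suc n))"
      "rescaled_profile (a n) (b n) (h n) (a (Suc n)) (b (Suc n)) (hs n)"
      "capillary_update \<beta> dt (a (Suc n)) (b (Suc n)) (hs n) (ht (Suc n))"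
      "\<And>x. x \<in> {a (Suc n)..b (Suc n)} \<Longrightarrow> h (Suc n) x = max (ht (Suc n) x) 0"
      "a n < b n" "a (Suc n) < b (Suc n)" if "Suc n \<le> N" for n
    using pm that unfolding projection_method_def by auto
  have bounds: "a 0 + \<sigma> * (real n * dt) \<le> a n \<and> a n \<le> a 0 + (1 + \<sigma>) * (real n * dt) \<and>
      b 0 - (1 + \<sigma>) * (real n * dt) \<le> b n \<and> b n \<le> b 0 - \<sigma> * (real n * dt)"
    using \<open>n \<le> N\<close>
  proof (induction n)
    case (Suc n)
    then show ?case
      using endpoint_update_bounds[OF step(1)[OF Suc.prems] \<open>0 < dt\<close>] by (simp add: algebra_simps)
  qed simp
  \<comment> \<open>The induction also carries absolute continuity and the zero boundary values,
    since the next step requires them of its profile.\<close>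
  have energy: "abs_cont_on (a n) (b n) (h n) \<and> h n (a n) = 0 \<and> h n (b n) = 0 \<and>
      graph_length (a n) (b n) (h n)
        + \<beta> / dt * (\<Sum>k=0..<n. dissipation (a (Suc k)) (b (Suc k)) (ht (Suc k)) (hs k))
        \<le> graph_length (a 0) (b 0) (h 0) + 2 * (real n * dt)"
    using \<open>n \<le> N\<close>
  proof (induction n)
    case 0
    then show ?case
      using pm by (simp add: projection_method_def)
  next
    case (Suc n)
    then have IH: "abs_cont_on (a n) (b n) (h n)" "h n (a n) = 0" "h n (b n) = 0"
        "graph_length (a n) (b n) (h n)
          + \<beta> / dt * (\<Sum>k=0..<n. dissipation (a (Suc k)) (b (Suc k)) (ht (Suc k)) (hs k))
          \<le> graph_length (a 0) (b 0) (h 0) + 2 * (real n * dt)"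
      by auto
    note new = projection_step[OF step[OF Suc.prems] \<open>0 < dt\<close> \<open>-1 < \<sigma>\<close> IH(1-3)]
    have "2 * (real (Suc n) * dt) = 2 * (real n * dt) + 2 * dt"
      by (simp add: algebra_simps)
    with new IH(4) show ?case
      by (simp add: distrib_left)
  qed
  show "a 0 + \<sigma> * (real n * dt) \<le> a n" "a n \<le> a 0 + (1 + \<sigma>) * (real n * dt)"
    "b 0 - (1 + \<sigma>) * (real n * dt) \<le> b n" "b n \<le> b 0 - \<sigma> * (real n * dt)"
    "graph_length (a n) (b n) (h n)
        + \<beta> / dt * (\<Sum>k=0..<n. dissipation (a (Suc k)) (b (Suc k)) (ht (Suc k)) (hs k))
        \<le> graph_length (a 0) (b 0) (h 0) + 2 * (real n * dt)"
    using bounds energy by auto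
qed

theorem proposition3p1:
  fixes \<beta> \<sigma> T dt :: real and N :: nat
    and a b :: "nat \<Rightarrow> real" and h hs ht :: "nat \<Rightarrow> real \<Rightarrow> real"
  assumes "\<beta> > 0" and "-1 < \<sigma>" and "\<sigma> < 0"
    and "T > 0" and "dt > 0" and "real N = T / dt"
    and "projection_method \<sigma> \<beta> dt N a b h hs ht"
  shows "(\<forall>n\<le>N. a 0 + \<sigma> * T \<le> a n \<and> a n \<le> a 0 + (1 + \<sigma>) * T \<and>
                 b 0 - (1 + \<sigma>) * T \<le> b n \<and> b n \<le> b 0 - \<sigma> * T) \<and>
         (MAX n\<in>{1..N}. integral {a n..b n} (\<lambda>x. sqrt (1 + (deriv (h n) x)\<^sup>2)))
           + \<beta> / dt * (\<Sum>n=0..<N. integral {a (Suc n)..b (Suc n)}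
               (\<lambda>x. \<bar>ht (Suc n) x - hs n x\<bar>\<^sup>2 / sqrt (1 + (deriv (ht (Suc n)) x)\<^sup>2)))
         \<le> 8 * T + 2 * integral {a 0..b 0} (\<lambda>x. sqrt (1 + (deriv (h 0) x)\<^sup>2))"
proof -
  note est = projection_method_estimates[OF assms(7,5,2)]
  have T: "real N * dt = T"
    using assms(5,6) by simp
  \<comment> \<open>This ensures that the maximum is taken over a nonempty set.\<close>
  then have "1 \<le> N"
    using assms(4) by (cases N) auto
  have time_le: "real n * dt \<le> T" if "n \<le> N" for n
    unfolding T[symmetric] using that assms(5) by simp
  have endpoints: "a 0 + \<sigma> * T \<le> a n \<and> a n \<le> a 0 + (1 + \<sigma>) * T \<and>
      b 0 - (1 + \<sigma>) * T \<le> b n \<and> b n \<le> b 0 - \<sigma> * T" if "n \<le> N" for n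
  proof -
    \<comment> \<open>As \<open>\<sigma> < 0 < 1 + \<sigma>\<close>, the bounds at time
      \<open>real n * dt\<close> only widen when the time is replaced by \<open>T\<close>.\<close>
    have "\<sigma> * T \<le> \<sigma> * (real n * dt)" "(1 + \<sigma>) * (real n * dt) \<le> (1 + \<sigma>) * T"
      using time_le[OF that] assms(2,3) by (simp_all add: mult_left_mono mult_left_mono_neg)
    then show ?thesis
      using est[OF that] by linarith
  qed
  let ?E0 = "graph_length (a 0) (b 0) (h 0)"
  let ?S = "\<lambda>n. \<beta> / dt * (\<Sum>k=0..<n. dissipation (a (Suc k)) (b (Suc k)) (ht (Suc k)) (hs k))"
  have S_nonneg: "0 \<le> ?S n" for n
    by (intro mult_nonneg_nonneg divide_nonneg_nonneg sum_nonneg dissipation_nonneg)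
      (use assms in auto)
  \<comment> \<open>For the maximum the nonnegative dissipation is dropped; for the sum, further
    below, the nonnegative final length is dropped.\<close>
  have "graph_length (a n) (b n) (h n) \<le> ?E0 + 2 * T" if "n \<le> N" for n
    using est(5)[OF that] S_nonneg[of n] time_le[OF that] by linarith
  then have "(MAX n\<in>{1..N}. graph_length (a n) (b n) (h n)) \<le> ?E0 + 2 * T"
    using \<open>1 \<le> N\<close> by (intro Max.boundedI) auto
  moreover have "?S N \<le> ?E0 + 2 * T"
    using est(5)[OF order_refl] graph_length_nonneg[of "a N" "b N" "h N"] by (simp add: T)
  \<comment> \<open>The two bounds add up to \<open>4 * T + 2 * ?E0\<close>, which is below the
    claimed bound because \<open>T > 0\<close>.\<close>
  ultimately have "(MAX n\<in>{1..N}. graph_length (a n) (b n) (h n)) + ?S N \<le> 8 * T + 2 * ?E0"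
    using assms(4) by linarith
  then have "(MAX n\<in>{1..N}. integral {a n..b n} (\<lambda>x. sqrt (1 + (deriv (h n) x)\<^sup>2)))
           + \<beta> / dt * (\<Sum>n=0..<N. integral {a (Suc n)..b (Suc n)}
               (\<lambda>x. \<bar>ht (Suc n) x - hs n x\<bar>\<^sup>2 / sqrt (1 + (deriv (ht (Suc n)) x)\<^sup>2)))
         \<le> 8 * T + 2 * integral {a 0..b 0} (\<lambda>x. sqrt (1 + (deriv (h 0) x)\<^sup>2))"
    unfolding graph_length_def dissipation_def .
  with endpoints show ?thesis
    by blast
qed

end
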